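(* Isolated bodies made of pressureless matter (a dust interior surrounded by a vacuum exterior) are incompatible with the junction conditions of Palatini $f(R)$ gravity listed in the context. Therefore, the Oppenheimer-Snyder model of gravitational collapse is also incompatible with such junction conditions.
   Context: Signature $(+,-,-,-)$, $c=1$, $\kappa=8\pi G$. An interior spacetime (labelled $-$) and an exterior spacetime (labelled $+$) are matched across a timelike hypersurface $\Sigma$, the surface of the body. Pressureless matter (dust) has stress-energy tensor $T^-_{\mu\nu}=\rho u_\mu u_\nu$, with $\rho$ the energy density and $u^\mu$ the unit timelike four-velocity, so that its trace is $T^-=\rho$; the exterior is vacuum, $T^+_{\mu\nu}=0$. For a quantity $Q$, $[Q]$ is its value on $\Sigma$ as approached from the exterior minus its value as approached from the interior. The junction conditions of Palatini $f(R)$ gravity considered are $$[h_{ab}]=0,\qquad [T]=0,\qquad [K_{ab}]-\tfrac13h_{ab}[K]=\frac{\kappa}{f_R}\tau_{ab},\qquad \tau=0,$$ where $h_{ab}$ is the induced metric on $\Sigma$, $T=g^{\mu\nu}T_{\mu\nu}$ is the trace of the stress-energy tensor, $K_{ab}$ is the extrinsic curvature of $\Sigma$ and $K=h^{ab}K_{ab}$, $f_R=df/dR$ (with $R$ the Ricci scalar of the independent connection), $\tau_{ab}$ is the stress-energy tensor of a possible thin shell on $\Sigma$ (the divergent part of the stress-energy tensor; $\tau_{ab}=0$ if there is no shell) and $\tau=h^{ab}\tau_{ab}$. Oppenheimer-Snyder model: the interior is a spatially uniform ball of dust collapsing under its own gravity, with metric $ds_-^2=d\bar\tau^2-a^2(\bar\tau)\left(\frac{d\chi^2}{1-k\chi^2}+\chi^2d\Omega_{(2)}^2\right)$,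 where $\bar\tau$ is proper time, $a$ is the scale factor, $k>0$ is a constant, $d\Omega_{(2)}^2$ is the metric of the unit two-sphere, and the density is $\rho(\bar\tau)=\rho_0/a^3(\bar\tau)$ with $\rho_0$ the initial density; the exterior is the vacuum Schwarzschild metric; and the matching surface is $\chi=\chi_*=\text{const}$.
   Formalization: For general dust bodies, the formal statement assumes the interior density does not tend to zero at every point of the surface; otherwise dust thinning to zero density there, joined smoothly to Schwarzschild with f(R)=R, satisfies all the conditions. The Oppenheimer-Snyder part needs no such assumption. *)

theory Defs
  imports "HOL-Analysis.Analysis"
begin

text \<open>
  Everything is expressed in local coordinates: a spacetime is described in a chart, the matching
  hypersurface by a patch of intrinsic coordinates together with one embedding into each chart.
  Indices have types 4 and 3; in type 4 the numeral 4 denotes the same element as 0.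
  The signature is (+,-,-,-).
\<close>

definition pd :: "'n::finite \<Rightarrow> (real^'n \<Rightarrow> 'b::real_normed_vector) \<Rightarrow> real^'n \<Rightarrow> 'b" where
  "pd i F x = frechet_derivative F (at x) (axis i 1)"

primrec Ck :: "nat \<Rightarrow> (real^'n::finite \<Rightarrow> 'b::real_normed_vector) \<Rightarrow> (real^'n) set \<Rightarrow> bool" where
  "Ck 0 F S = continuous_on S F"
| "Ck (Suc k) F S = (F differentiable_on S \<and> (\<forall>i. Ck k (pd i F) S))"

definition diag :: "('n::finite \<Rightarrow> real) \<Rightarrow> real^'n^'n" where
  "diag d = (\<chi> i j. if i = j then d i else 0)"

definition lorentzian :: "real^'n::{finite,one}^'n::{finite,one} \<Rightarrow> bool" where
  "lorentzian G \<longleftrightarrow> transpose G = G \<and>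
     (\<exists>E :: real^'n::{finite,one}^'n::{finite,one}.
       invertible E \<and> transpose E ** G ** E = diag (\<lambda>i. if i = 1 then 1 else - 1))"

definition gdot :: "real^'n::finite^'n \<Rightarrow> real^'n \<Rightarrow> real^'n \<Rightarrow> real" where
  "gdot G v w = v \<bullet> (G *v w)"

definition gtrace :: "real^'n::finite^'n \<Rightarrow> real^'n^'n \<Rightarrow> real" where
  "gtrace G A = (\<Sum>i\<in>UNIV. \<Sum>j\<in>UNIV. matrix_inv G $ i $ j * A $ i $ j)"

text \<open>
  The four functions are the metric with lower indices, the components
  \<open>\<lambda>l m n. \<Gamma>\<^sup>l\<^sub>m\<^sub>n\<close> of the independent (Palatini) connection, and the stress-energy tensor with
  lower indices. The region does not contain the matching hypersurface, which lies in its frontier.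
\<close>

record spacetime =
  region :: "(real^4) set"
  metric :: "real^4 \<Rightarrow> real^4^4"
  conn :: "real^4 \<Rightarrow> 4 \<Rightarrow> 4 \<Rightarrow> 4 \<Rightarrow> real"
  stress :: "real^4 \<Rightarrow> real^4^4"

definition spacetime_ok :: "spacetime \<Rightarrow> bool" where
  "spacetime_ok S \<longleftrightarrow>
     open (region S) \<and> Ck 2 (metric S) (region S) \<and>
     (\<forall>l m n. Ck 1 (\<lambda>x. conn S x l m n) (region S)) \<and>
     continuous_on (region S) (stress S) \<and>
     (\<forall>x\<in>region S. lorentzian (metric S x) \<and> transpose (stress S x) = stress S x)"

definition levi_civita :: "(real^4 \<Rightarrow> real^4^4) \<Rightarrow> real^4 \<Rightarrow> 4 \<Rightarrow> 4 \<Rightarrow> 4 \<Rightarrow> real" where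
  "levi_civita g x l m n = (\<Sum>s\<in>UNIV. matrix_inv (g x) $ l $ s *
     (pd m (\<lambda>z. g z $ s $ n) x + pd n (\<lambda>z. g z $ s $ m) x - pd s (\<lambda>z. g z $ m $ n) x)) / 2"

text \<open>Ricci tensor \<open>R\<^sub>m\<^sub>n = R\<^sup>l\<^sub>m\<^sub>l\<^sub>n\<close> and Ricci scalar of the independent connection.\<close>

definition ricci :: "(real^4 \<Rightarrow> 4 \<Rightarrow> 4 \<Rightarrow> 4 \<Rightarrow> real) \<Rightarrow> real^4 \<Rightarrow> real^4^4" where
  "ricci C x = (\<chi> m n.
     (\<Sum>l\<in>UNIV. pd l (\<lambda>z. C z l n m) x - pd n (\<lambda>z. C z l l m) x
       + (\<Sum>s\<in>UNIV. C x l l s * C x s n m - C x l n s * C x s l m)))"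

definition ricci_scalar :: "spacetime \<Rightarrow> real^4 \<Rightarrow> real" where
  "ricci_scalar S x = gtrace (metric S x) (ricci (conn S) x)"

definition stress_trace :: "spacetime \<Rightarrow> real^4 \<Rightarrow> real" where
  "stress_trace S x = gtrace (metric S x) (stress S x)"

text \<open>One-sided value at a boundary point \<open>p\<close>, as approached from the region.\<close>

definition bv :: "spacetime \<Rightarrow> (real^4 \<Rightarrow> 'b::t2_space) \<Rightarrow> real^4 \<Rightarrow> 'b" where
  "bv S Q p = Lim (at p within region S) Q"

definition has_bv :: "spacetime \<Rightarrow> (real^4 \<Rightarrow> 'b::t2_space) \<Rightarrow> real^4 \<Rightarrow> bool" where
  "has_bv S Q p \<longleftrightarrow> (\<exists>l. (Q \<longlongrightarrow> l) (at p within region S))"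

definition induced_metric :: "spacetime \<Rightarrow> (real^3 \<Rightarrow> real^4) \<Rightarrow> real^3 \<Rightarrow> real^3^3" where
  "induced_metric S X y = (\<chi> a b. gdot (bv S (metric S) (X y)) (pd a X y) (pd b X y))"

text \<open>
  \<open>K\<^sub>a\<^sub>b = e\<^sub>a\<^sup>r e\<^sub>b\<^sup>s \<nabla>\<^sub>r n\<^sub>s = - n\<^sub>m (\<partial>\<^sub>a \<partial>\<^sub>b X\<^sup>m + \<Gamma>\<^sup>m\<^sub>r\<^sub>s e\<^sub>a\<^sup>r e\<^sub>b\<^sup>s)\<close> with the tangent vectors
  \<open>e\<^sub>a = \<partial>\<^sub>a X\<close>, the unit normal \<open>n\<close>, and the Levi-Civita connection of the spacetime metric.
\<close>

definition ext_curvature ::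
  "spacetime \<Rightarrow> (real^3 \<Rightarrow> real^4) \<Rightarrow> (real^3 \<Rightarrow> real^4) \<Rightarrow> real^3 \<Rightarrow> real^3^3" where
  "ext_curvature S X n y = (\<chi> a b. - gdot (bv S (metric S) (X y)) (n y)
     (pd a (pd b X) y +
      (\<chi> m. \<Sum>r\<in>UNIV. \<Sum>s\<in>UNIV.
        bv S (\<lambda>x. levi_civita (metric S) x m r s) (X y) * pd a X y $ r * pd b X y $ s)))"

definition hypersurface_patch :: "(real^3) set \<Rightarrow> (real^3 \<Rightarrow> real^4) \<Rightarrow> bool" where
  "hypersurface_patch V X \<longleftrightarrow>
     open V \<and> V \<noteq> {} \<and> Ck 2 X V \<and> (\<exists>Y. homeomorphism V (X ` V) X Y)"

text \<open>
  The patch is a timelike boundary of the region, up to which the geometry and the matter extend,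
  with unit normal \<open>n\<close>. The sign \<open>\<sigma>\<close> says on which side of the hypersurface the region lies:
  \<open>n\<close> points into the region if \<open>\<sigma> = 1\<close> and out of it if \<open>\<sigma> = -1\<close>.
\<close>

definition timelike_boundary ::
  "spacetime \<Rightarrow> (real^3) set \<Rightarrow> (real^3 \<Rightarrow> real^4) \<Rightarrow> (real^3 \<Rightarrow> real^4) \<Rightarrow> real \<Rightarrow> bool" where
  "timelike_boundary S V X n \<sigma> \<longleftrightarrow> hypersurface_patch V X \<and>
     (\<forall>y\<in>V. X y \<in> frontier (region S) \<and>
        has_bv S (metric S) (X y) \<and> lorentzian (bv S (metric S) (X y)) \<and>
        (\<forall>l m r. has_bv S (\<lambda>x. levi_civita (metric S) x l m r) (X y)) \<and>
        has_bv S (stress S) (X y) \<and> has_bv S (ricci_scalar S) (X y) \<and>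
        lorentzian (induced_metric S X y) \<and>
        (\<forall>a. gdot (bv S (metric S) (X y)) (n y) (pd a X y) = 0) \<and>
        gdot (bv S (metric S) (X y)) (n y) (n y) = - 1 \<and>
        (\<forall>\<^sub>F s in at_right 0. X y + (\<sigma> * s) *\<^sub>R n y \<in> region S \<and>
                               X y - (\<sigma> * s) *\<^sub>R n y \<notin> region S))"

text \<open>
  An interior \<open>Sm\<close> and an exterior \<open>Sp\<close> that share the hypersurface patch \<open>V\<close>, with the normals
  pointing from the interior to the exterior. The field \<open>\<tau>\<close> is the stress-energy tensor of a
  possible thin shell, zero if there is none.

  The Ricci scalar is an algebraic function of \<open>T\<close> in Palatini gravity, so once \<open>[T] = 0\<close> holds
  its value on the hypersurface is the same from both sides; the exterior one is used for \<open>f\<^sub>R\<close>.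
\<close>

definition surface_R :: "spacetime \<Rightarrow> (real^3 \<Rightarrow> real^4) \<Rightarrow> real^3 \<Rightarrow> real" where
  "surface_R Sp Xp y = bv Sp (ricci_scalar Sp) (Xp y)"

definition matched_spacetimes ::
  "(real \<Rightarrow> real) \<Rightarrow> spacetime \<Rightarrow> spacetime \<Rightarrow> (real^3) set \<Rightarrow> (real^3 \<Rightarrow> real^4) \<Rightarrow>
   (real^3 \<Rightarrow> real^4) \<Rightarrow> (real^3 \<Rightarrow> real^4) \<Rightarrow> (real^3 \<Rightarrow> real^4) \<Rightarrow> (real^3 \<Rightarrow> real^3^3) \<Rightarrow> bool" where
  "matched_spacetimes f Sm Sp V Xm Xp nm np \<tau> \<longleftrightarrow>
     spacetime_ok Sm \<and> spacetime_ok Sp \<and>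
     timelike_boundary Sm V Xm nm (- 1) \<and> timelike_boundary Sp V Xp np 1 \<and>
     (\<forall>y\<in>V. f differentiable (at (surface_R Sp Xp y)) \<and> deriv f (surface_R Sp Xp y) \<noteq> 0 \<and>
            transpose (\<tau> y) = \<tau> y)"

text \<open>
  In the third and fourth conditions \<open>h\<^sub>a\<^sub>b\<close> is taken from the interior side; the first condition
  says that this is also the induced metric from the exterior side.
\<close>

definition junction_conditions ::
  "real \<Rightarrow> (real \<Rightarrow> real) \<Rightarrow> spacetime \<Rightarrow> spacetime \<Rightarrow> (real^3) set \<Rightarrow> (real^3 \<Rightarrow> real^4) \<Rightarrow>
   (real^3 \<Rightarrow> real^4) \<Rightarrow> (real^3 \<Rightarrow> real^4) \<Rightarrow> (real^3 \<Rightarrow> real^4) \<Rightarrow> (real^3 \<Rightarrow> real^3^3) \<Rightarrow> bool" where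
  "junction_conditions \<kappa> f Sm Sp V Xm Xp nm np \<tau> \<longleftrightarrow> (\<forall>y\<in>V.
     let hm = induced_metric Sm Xm y; hp = induced_metric Sp Xp y;
         Km = ext_curvature Sm Xm nm y; Kp = ext_curvature Sp Xp np y
     in hp - hm = 0 \<and>
        bv Sp (stress_trace Sp) (Xp y) - bv Sm (stress_trace Sm) (Xm y) = 0 \<and>
        (Kp - Km) - (1/3 * (gtrace hp Kp - gtrace hm Km)) *\<^sub>R hm
          = (\<kappa> / deriv f (surface_R Sp Xp y)) *\<^sub>R \<tau> y \<and>
        gtrace hm (\<tau> y) = 0)"

definition vacuum :: "spacetime \<Rightarrow> bool" where
  "vacuum S \<longleftrightarrow> (\<forall>x\<in>region S. stress S x = 0)"

text \<open>\<open>T\<^sub>m\<^sub>n = \<rho> u\<^sub>m u\<^sub>n\<close> with the unit timelike four-velocity \<open>u\<close> (upper index).\<close>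

definition dust :: "spacetime \<Rightarrow> (real^4 \<Rightarrow> real) \<Rightarrow> (real^4 \<Rightarrow> real^4) \<Rightarrow> bool" where
  "dust S \<rho> u \<longleftrightarrow> (\<forall>x\<in>region S.
     gdot (metric S x) (u x) (u x) = 1 \<and>
     stress S x = (\<chi> m n. \<rho> x * (metric S x *v u x) $ m * (metric S x *v u x) $ n))"

text \<open>
  The matter does not thin out to zero density at its surface: somewhere on the patch the density,
  as approached from the interior, is nonzero.
\<close>

definition isolated_dust_body ::
  "spacetime \<Rightarrow> spacetime \<Rightarrow> (real^3) set \<Rightarrow> (real^3 \<Rightarrow> real^4) \<Rightarrow>
   (real^4 \<Rightarrow> real) \<Rightarrow> (real^4 \<Rightarrow> real^4) \<Rightarrow> bool" where
  "isolated_dust_body Sm Sp V Xm \<rho> u \<longleftrightarrow>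
     dust Sm \<rho> u \<and> vacuum Sp \<and> (\<exists>y\<in>V. bv Sm \<rho> (Xm y) \<noteq> 0)"

text \<open>
  The interior coordinates are (proper time, \<open>\<chi>\<close>, \<open>\<theta>\<close>, \<open>\<phi>\<close>), the exterior ones the Schwarzschild
  coordinates (t, r, \<open>\<theta>\<close>, \<open>\<phi>\<close>), those on the surface (proper time, \<open>\<theta>\<close>, \<open>\<phi>\<close>).
\<close>

definition os_metric :: "real \<Rightarrow> (real \<Rightarrow> real) \<Rightarrow> real^4 \<Rightarrow> real^4^4" where
  "os_metric k a x = diag (\<lambda>i.
     if i = 1 then 1
     else if i = 2 then - (a (x$1))\<^sup>2 / (1 - k * (x$2)\<^sup>2)
     else if i = 3 then - (a (x$1))\<^sup>2 * (x$2)\<^sup>2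
     else - (a (x$1))\<^sup>2 * (x$2)\<^sup>2 * (sin (x$3))\<^sup>2)"

text \<open>The dust is comoving, and \<open>\<rho>\<^sub>0\<close> is its density when the scale factor is 1.\<close>

definition os_interior ::
  "real \<Rightarrow> (real \<Rightarrow> real) \<Rightarrow> real \<Rightarrow> real \<Rightarrow> real \<Rightarrow> real \<Rightarrow> spacetime \<Rightarrow> bool" where
  "os_interior k a \<rho>0 \<chi>s t1 t2 S \<longleftrightarrow>
     0 < k \<and> 0 < \<rho>0 \<and> 0 < \<chi>s \<and> k * \<chi>s\<^sup>2 < 1 \<and> (\<forall>t\<in>{t1<..<t2}. 0 < a t) \<and>
     region S = {x. t1 < x$1 \<and> x$1 < t2 \<and> 0 < x$2 \<and> x$2 < \<chi>s \<and> 0 < x$3 \<and> x$3 < pi \<and>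
                    - pi < x$4 \<and> x$4 < pi} \<and>
     (\<forall>x\<in>region S. metric S x = os_metric k a x) \<and>
     dust S (\<lambda>x. \<rho>0 / (a (x$1)) ^ 3) (\<lambda>x. axis 1 1)"

definition os_surface :: "real \<Rightarrow> real \<Rightarrow> real \<Rightarrow> (real^3) set \<Rightarrow> (real^3 \<Rightarrow> real^4) \<Rightarrow> bool" where
  "os_surface \<chi>s t1 t2 V X \<longleftrightarrow>
     V \<subseteq> {y. t1 < y$1 \<and> y$1 < t2 \<and> 0 < y$2 \<and> y$2 < pi \<and> - pi < y$3 \<and> y$3 < pi} \<and>
     (\<forall>y\<in>V. X y = (\<chi> i. if i = 1 then y$1 else if i = 2 then \<chi>s else if i = 3 then y$2 else y$3))"

definition schwarzschild_metric :: "real \<Rightarrow> real \<Rightarrow> real^4 \<Rightarrow> real^4^4" where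
  "schwarzschild_metric G M x = diag (\<lambda>i.
     if i = 1 then 1 - 2 * G * M / x$2
     else if i = 2 then - 1 / (1 - 2 * G * M / x$2)
     else if i = 3 then - (x$2)\<^sup>2
     else - (x$2)\<^sup>2 * (sin (x$3))\<^sup>2)"

definition schwarzschild_chart :: "real \<Rightarrow> real \<Rightarrow> (real^4) set" where
  "schwarzschild_chart G M = {x. 0 < x$2 \<and> x$2 \<noteq> 2 * G * M \<and> 0 < x$3 \<and> x$3 < pi \<and>
                                 - pi < x$4 \<and> x$4 < pi}"

text \<open>
  The embedding of the surface into the Schwarzschild spacetime is not prescribed: it describes how
  the ball collapses.
\<close>

definition schwarzschild_exterior ::
  "real \<Rightarrow> real \<Rightarrow> spacetime \<Rightarrow> (real^3) set \<Rightarrow> (real^3 \<Rightarrow> real^4) \<Rightarrow> bool" where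
  "schwarzschild_exterior G M S V X \<longleftrightarrow>
     0 < M \<and> region S \<union> X ` V \<subseteq> schwarzschild_chart G M \<and>
     (\<forall>x\<in>region S. metric S x = schwarzschild_metric G M x) \<and> vacuum S"

end

theory Submission
  imports Defs
begin

text \<open>
  The trace of the dust stress-energy tensor is the density, while that of the vacuum vanishes, so
  \<open>[T] = 0\<close> forces the density to tend to zero at the surface. In the Oppenheimer-Snyder interior
  the density depends on proper time only, so it is a positive constant along every ray of constant
  time that reaches the surface.
\<close>

text \<open>Taking determinants in the congruence to the Minkowski form gives a product of factors 1
  and -1 on the right, so \<open>det G\<close> cannot vanish.\<close>

lemma lorentzian_invertible:
  fixes G :: "real^'n::{finite,one}^'n::{finite,one}"
  assumes "lorentzian G"
  shows "invertible G"
proof -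
  from assms obtain E :: "real^'n::{finite,one}^'n::{finite,one}"
    where "transpose E ** G ** E = diag (\<lambda>i. if i = 1 then 1 else - 1)"
    unfolding lorentzian_def by blast
  then have "det (transpose E) * det G * det E = det (diag (\<lambda>i::'n. if i = 1 then 1 else - 1))"
    by (metis det_mul)
  also have "\<dots> = (\<Prod>i\<in>UNIV. if i = (1::'n) then 1 else - 1)"
    by (subst det_diagonal) (auto simp: diag_def)
  also have "\<dots> \<noteq> 0"
    by simp
  finally show ?thesis
    by (auto simp: invertible_det_nz)
qed

lemma matrix_inv_left:
  assumes "invertible A"
  shows "matrix_inv A ** A = mat 1"
  using someI_ex[OF assms[unfolded invertible_def]] by (simp add: matrix_inv_def)

text \<open>The trace contracts the covector \<open>w = G *v v\<close> with
  \<open>matrix_inv G *v w\<close>, and raising the lowered index returns \<open>v\<close>. For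
  dust, \<open>r\<close> is the density and \<open>v\<close> the unit four-velocity, so the trace is
  the density itself.\<close>

lemma gtrace_rank_one:
  assumes "invertible G"
  shows "gtrace G (\<chi> i j. r * (G *v v) $ i * (G *v v) $ j) = r * gdot G v v"
proof -
  have "gtrace G (\<chi> i j. r * w $ i * w $ j) = r * (w \<bullet> (matrix_inv G *v w))" for w
    by (simp add: gtrace_def inner_vec_def matrix_vector_mult_def sum_distrib_left mult_ac)
  then have "gtrace G (\<chi> i j. r * (G *v v) $ i * (G *v v) $ j)
      = r * ((G *v v) \<bullet> (matrix_inv G *v (G *v v)))" .
  also have "matrix_inv G *v (G *v v) = v"
    using assms by (simp add: matrix_vector_mul_assoc matrix_inv_left)
  finally show ?thesis
    by (simp add: gdot_def inner_commute)
qed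

lemma stress_trace_dust:
  assumes "spacetime_ok S" "dust S \<rho> u" "x \<in> region S"
  shows "stress_trace S x = \<rho> x"
  using assms gtrace_rank_one[OF lorentzian_invertible, of "metric S x" "\<rho> x" "u x"]
  by (simp add: stress_trace_def spacetime_ok_def dust_def)

lemma stress_trace_vacuum:
  assumes "vacuum S" "x \<in> region S"
  shows "stress_trace S x = 0"
  using assms by (simp add: stress_trace_def vacuum_def gtrace_def)

text \<open>\<open>Lim\<close> depends on a function only through the set of its limits, so the
  equality needs no existence of a limit. This allows the density and the stress trace to be
  exchanged before any limit is known.\<close>

lemma bv_cong:
  assumes "\<And>x. x \<in> region S \<Longrightarrow> P x = Q x"
  shows "bv S P p = bv S Q p"
proof -
  have "\<forall>\<^sub>F x in at p within region S. P x = Q x"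
    using assms by (simp add: eventually_at_filter)
  then have "(P \<longlongrightarrow> l) (at p within region S) \<longleftrightarrow> (Q \<longlongrightarrow> l) (at p within region S)" for l
    by (rule tendsto_cong)
  then show ?thesis
    by (simp add: bv_def Topological_Spaces.Lim_def)
qed

lemma bv_eqI:
  assumes "at p within region S \<noteq> bot" "(Q \<longlongrightarrow> l) (at p within region S)"
  shows "bv S Q p = l"
  using assms by (simp add: bv_def tendsto_Lim)

text \<open>A frontier point of an open set lies in its closure but outside the set, hence is a
  limit point. One-sided limits at the surface are therefore unique.\<close>

lemma at_within_frontier_nontrivial:
  fixes p :: "'a::topological_space"
  assumes "open S" "p \<in> frontier S"
  shows "at p within S \<noteq> bot"
  using assms
  by (metis Diff_empty Diff_iff Diff_insert0 closure_def frontier_def interior_open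
      mem_Collect_eq trivial_limit_within Un_iff)

lemma timelike_boundary_nontrivial:
  assumes "spacetime_ok S" "timelike_boundary S V X n \<sigma>" "y \<in> V"
  shows "at (X y) within region S \<noteq> bot"
  using assms
  by (intro at_within_frontier_nontrivial) (auto simp: timelike_boundary_def spacetime_ok_def)

lemma junction_dust_vacuum_density_zero:
  assumes "matched_spacetimes f Sm Sp V Xm Xp nm np \<tau>"
    and "junction_conditions \<kappa> f Sm Sp V Xm Xp nm np \<tau>"
    and "dust Sm \<rho> u" "vacuum Sp" "y \<in> V"
  shows "bv Sm \<rho> (Xm y) = 0"
proof -
  have ok: "spacetime_ok Sm"
    using assms(1) by (simp add: matched_spacetimes_def)
  have "bv Sm \<rho> (Xm y) = bv Sm (stress_trace Sm) (Xm y)"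
    by (rule bv_cong) (simp add: stress_trace_dust[OF ok assms(3)])
  also have "\<dots> = bv Sp (stress_trace Sp) (Xp y)"
    using assms(2,5) by (simp add: junction_conditions_def Let_def)
  also have "\<dots> = bv Sp (\<lambda>x. 0) (Xp y)"
    by (rule bv_cong) (simp add: stress_trace_vacuum[OF assms(4)])
  \<comment> \<open>The filter on the exterior side is nontrivial, so the constant function has 0 as
    its only limit.\<close>
  also have "\<dots> = 0"
    using assms(1,5)
    by (intro bv_eqI timelike_boundary_nontrivial) (auto simp: matched_spacetimes_def)
  finally show ?thesis .
qed

text \<open>Lowering the comoving velocity with \<open>g\<close> gives the covector with sole entry
  1 in the time slot. The density is thus a stress component and inherits its limit at the
  surface.\<close>

lemma os_stress_time_time:
  assumes "os_interior k a \<rho>0 \<chi>s t1 t2 S" "x \<in> region S"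
  shows "stress S x $ 1 $ 1 = \<rho>0 / (a (x$1)) ^ 3"
  using assms
  by (simp add: os_interior_def dust_def os_metric_def diag_def matrix_vector_mul_component
      inner_axis)

text \<open>Moving inward changes only the radial coordinate; time and angles stay those of the
  surface point. A limit taken within the region may hence be evaluated along this ray.\<close>

lemma os_surface_inward_ray:
  assumes "os_interior k a \<rho>0 \<chi>s t1 t2 S" "os_surface \<chi>s t1 t2 V X" "y \<in> V"
  shows "filterlim (\<lambda>s. X y - s *\<^sub>R axis 2 1) (at (X y) within region S) (at_right 0)"
proof -
  have X: "X y $ 1 = y $ 1" "X y $ 2 = \<chi>s" "X y $ 3 = y $ 2" "X y $ 4 = y $ 3"
    using assms(2,3) by (auto simp: os_surface_def)
  have "0 < \<chi>s"
    using assms(1) by (simp add: os_interior_def)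
  \<comment> \<open>These bounds keep the radial coordinate \<open>\<chi>s - s\<close> strictly
    between 0 and \<open>\<chi>s\<close>.\<close>
  then have "\<forall>\<^sub>F s in at_right 0. 0 < s \<and> s < \<chi>s"
    by (auto simp: eventually_at_right_field)
  then have "\<forall>\<^sub>F s in at_right 0. X y - s *\<^sub>R axis 2 1 \<in> region S \<and> X y - s *\<^sub>R axis 2 1 \<noteq> X y"
  proof (rule eventually_mono)
    fix s assume "0 < s \<and> s < \<chi>s"
    then show "X y - s *\<^sub>R axis 2 1 \<in> region S \<and> X y - s *\<^sub>R axis 2 1 \<noteq> X y"
      using assms X by (auto simp: os_interior_def os_surface_def axis_def vec_eq_iff)
  qed
  moreover have "((\<lambda>s. X y - s *\<^sub>R axis 2 1) \<longlongrightarrow> X y) (at_right 0)"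
    by (auto intro!: tendsto_eq_intros)
  ultimately show ?thesis
    by (simp add: filterlim_at)
qed

text \<open>The boundary value of the stress tensor supplies existence of the limit, and the inward
  ray identifies it.\<close>

lemma os_density_at_surface:
  assumes "os_interior k a \<rho>0 \<chi>s t1 t2 S" "os_surface \<chi>s t1 t2 V X" "y \<in> V"
    and "has_bv S (stress S) (X y)" "at (X y) within region S \<noteq> bot"
  shows "bv S (\<lambda>x. \<rho>0 / (a (x$1)) ^ 3) (X y) = \<rho>0 / (a (y$1)) ^ 3"
proof -
  let ?\<rho> = "\<lambda>x. \<rho>0 / (a (x$1)) ^ 3"
  obtain l where "(stress S \<longlongrightarrow> l) (at (X y) within region S)"
    using assms(4) by (auto simp: has_bv_def)
  then have "((\<lambda>x. stress S x $ 1 $ 1) \<longlongrightarrow> l $ 1 $ 1) (at (X y) within region S)"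
    by (intro tendsto_vec_nth)
  moreover have "\<forall>\<^sub>F x in at (X y) within region S. stress S x $ 1 $ 1 = ?\<rho> x"
    using os_stress_time_time[OF assms(1)] by (simp add: eventually_at_filter)
  ultimately have lim: "(?\<rho> \<longlongrightarrow> l $ 1 $ 1) (at (X y) within region S)"
    by (rule Lim_transform_eventually)
  have "X y $ 1 = y $ 1"
    using assms(2,3) by (auto simp: os_surface_def)
  \<comment> \<open>The time coordinate is \<open>y$1\<close> all along the ray, so the composed
    density is constant.\<close>
  then have "((\<lambda>s::real. \<rho>0 / (a (y$1)) ^ 3) \<longlongrightarrow> l $ 1 $ 1) (at_right 0)"
    using filterlim_compose[OF lim os_surface_inward_ray[OF assms(1-3)]] by (simp add: axis_def)
  then have "l $ 1 $ 1 = \<rho>0 / (a (y$1)) ^ 3"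
    by (simp add: tendsto_const_iff)
  then show ?thesis
    using bv_eqI[OF assms(5) lim] by simp
qed

theorem mainTheorem8:
  fixes G \<kappa> :: real and f :: "real \<Rightarrow> real" and Sm Sp :: spacetime
    and V :: "(real^3) set" and Xm Xp nm np :: "real^3 \<Rightarrow> real^4" and \<tau> :: "real^3 \<Rightarrow> real^3^3"
  assumes "G > 0" and "\<kappa> = 8 * pi * G"
    and "matched_spacetimes f Sm Sp V Xm Xp nm np \<tau>"
  shows "(\<forall>\<rho> u. isolated_dust_body Sm Sp V Xm \<rho> u \<longrightarrow>
            \<not> junction_conditions \<kappa> f Sm Sp V Xm Xp nm np \<tau>) \<and>
         (\<forall>k a \<rho>0 \<chi>s t1 t2 M.
            os_interior k a \<rho>0 \<chi>s t1 t2 Sm \<and> os_surface \<chi>s t1 t2 V Xm \<and>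
            schwarzschild_exterior G M Sp V Xp \<longrightarrow>
            \<not> junction_conditions \<kappa> f Sm Sp V Xm Xp nm np \<tau>)"
proof -
  have incompatible: "\<not> junction_conditions \<kappa> f Sm Sp V Xm Xp nm np \<tau>"
    if "isolated_dust_body Sm Sp V Xm \<rho> u" for \<rho> u
    using that junction_dust_vacuum_density_zero[OF assms(3)]
    by (auto simp: isolated_dust_body_def)
  have "\<not> junction_conditions \<kappa> f Sm Sp V Xm Xp nm np \<tau>"
    if os: "os_interior k a \<rho>0 \<chi>s t1 t2 Sm" "os_surface \<chi>s t1 t2 V Xm"
      and ext: "schwarzschild_exterior G M Sp V Xp" for k a \<rho>0 \<chi>s t1 t2 M
  proof -
    obtain y where y: "y \<in> V"
      using assms(3)
      by (auto simp: matched_spacetimes_def timelike_boundary_def hypersurface_patch_def)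
    have bdry: "spacetime_ok Sm" "timelike_boundary Sm V Xm nm (- 1)"
      using assms(3) by (simp_all add: matched_spacetimes_def)
    then have "has_bv Sm (stress Sm) (Xm y)"
      using y by (simp add: timelike_boundary_def)
    then have "bv Sm (\<lambda>x. \<rho>0 / (a (x$1)) ^ 3) (Xm y) = \<rho>0 / (a (y$1)) ^ 3"
      using os_density_at_surface[OF os y] timelike_boundary_nontrivial[OF bdry y] by blast
    moreover have "0 < \<rho>0" "0 < a (y$1)"
      using os y by (auto simp: os_interior_def os_surface_def)
    ultimately have "bv Sm (\<lambda>x. \<rho>0 / (a (x$1)) ^ 3) (Xm y) \<noteq> 0"
      by simp
    \<comment> \<open>The collapse model is now an instance of the general dust body, with
      \<open>y\<close> as the surface point of nonzero density.\<close>
    then have "isolated_dust_body Sm Sp V Xm (\<lambda>x. \<rho>0 / (a (x$1)) ^ 3) (\<lambda>x. axis 1 1)"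
      using os(1) ext y
      by (auto simp: isolated_dust_body_def os_interior_def schwarzschild_exterior_def)
    then show ?thesis
      by (rule incompatible)
  qed
  with incompatible show ?thesis
    by blast
qed

end
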